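(* Define integers $\hat N_k$ for $k\ge 3$ recursively by $\hat N_3 = 9$, $\hat N_4 = 24$, and, for $k\ge 5$, $$\hat N_k = \min_{3\le t<k} N(k,t,\hat N_t,1).$$ Then for every $k\ge 3$, $\hat N_k$ is an upper bound for $N_k$, i.e. $N_k\le \hat N_k$ (so a geometric $(n_k)$ configuration exists for every $n\ge \hat N_k$).
   Context: A geometric $(n_k)$ configuration is a set of $n$ distinct points and $n$ distinct (straight) lines in the real Euclidean plane such that each of the points lies on exactly $k$ of the lines and each of the lines contains exactly $k$ of the points. $N_k$ denotes the smallest positive integer such that for every $n\ge N_k$ there exists a geometric $(n_k)$ configuration. For positive integers $k,t,a,d$ with $t<k$, the function $N(k,t,a,d)$ is defined by $$N(k,t,a,d) = (k^2-1)\,\frac{k!}{(t+1)!}\,\max\{a,\,(k^2-1)d\}\quad\text{if } t<k-1,$$ $$N(k,k-1,a,d) = (k^2-1)\,\max\{a,\,(k^2-1)d-1\}\quad\text{if } t=k-1.$$ The initial values come from known results taken as given in the literature: $N_3=9$ (a geometric $(n_3)$ configuration exists if and only if $n\ge 9$), and geometric $(n_4)$ configurations exist for all $n\ge 24$, so that $24$ is the best known upper bound for $N_4$. *)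

theory Defs
  imports "HOL-Analysis.Analysis"
begin

definition is_line :: "(real ^ 2) set \<Rightarrow> bool" where
  "is_line l \<longleftrightarrow> affine l \<and> aff_dim l = 1"

definition geometric_configuration ::
  "nat \<Rightarrow> nat \<Rightarrow> (real ^ 2) set \<Rightarrow> (real ^ 2) set set \<Rightarrow> bool" where
  "geometric_configuration n k P L \<longleftrightarrow>
     finite P \<and> card P = n \<and>
     finite L \<and> card L = n \<and>
     (\<forall>l\<in>L. is_line l) \<and>
     (\<forall>p\<in>P. card {l \<in> L. p \<in> l} = k) \<and>
     (\<forall>l\<in>L. card {p \<in> P. p \<in> l} = k)"

definition geometric_configuration_exists :: "nat \<Rightarrow> nat \<Rightarrow> bool" where
  "geometric_configuration_exists n k \<longleftrightarrow> (\<exists>P L. geometric_configuration n k P L)"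

(* Meaningful only for those k for which some threshold exists; otherwise the LEAST is
   an unspecified number. *)
definition config_threshold :: "nat \<Rightarrow> nat" where
  "config_threshold k =
     (LEAST N. 0 < N \<and> (\<forall>n\<ge>N. geometric_configuration_exists n k))"

(* Intended for positive k, t, a, d with t < k, where the division of factorials is exact
   and none of the natural-number subtractions truncates. *)
definition N_bound :: "nat \<Rightarrow> nat \<Rightarrow> nat \<Rightarrow> nat \<Rightarrow> nat" where
  "N_bound k t a d =
     (if t < k - 1
      then (k\<^sup>2 - 1) * (fact k div fact (t + 1)) * max a ((k\<^sup>2 - 1) * d)
      else (k\<^sup>2 - 1) * max a ((k\<^sup>2 - 1) * d - 1))"

(* The value 0 for k < 3 is a dummy; the recursion only calls arguments t \<ge> 3. *)
fun N_hat :: "nat \<Rightarrow> nat" where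
  "N_hat k =
     (if k < 3 then 0
      else if k = 3 then 9
      else if k = 4 then 24
      else Min ((\<lambda>t. N_bound k t (N_hat t) 1) ` {3..<k}))"

(* The defining equation loops as a rewrite rule. *)
declare N_hat.simps [simp del]

end

theory Submission
  imports Defs
begin

text \<open>
  After a shear no line is vertical, so a pair \<open>(a, b)\<close> encodes the line \<open>y = a x + b\<close>.
  \<^emph>\<open>Affine replication\<close> takes the images of a generic \<open>(m\<^sub>k)\<close> configuration under \<open>k + 1\<close> maps
  \<open>(x, y) \<mapsto> (c x, y)\<close>. The images of a line meet in one point of the axis \<open>x = 0\<close>, and the images
  of a point lie on one horizontal line; adding these points and lines gives an
  \<open>(((k + 2) m)\<^sub>k\<^sub>+\<^sub>1)\<close> configuration with \<open>m\<close> parallel lines.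
  \<^emph>\<open>Affine switch\<close> takes the images of an \<open>(M\<^sub>k)\<close> configuration under \<open>k - 1\<close> maps
  \<open>(x, y) \<mapsto> (c x, y + c)\<close>. The images of a point \<open>(x, h)\<close> lie on a line through \<open>(0, h)\<close>, so all images
  of \<open>r\<close> horizontal lines \<open>y = h\<close> can be exchanged for such lines together with the \<open>r\<close> points \<open>(0, h)\<close>,
  which gives \<open>(k - 1) M + r\<close> points.
  Replicating \<open>(m\<^sub>t)\<close> up to \<open>k\<close> with \<open>c = k! / (t + 1)!\<close> and then switching yields all sizes
  \<open>(k\<^sup>2 - 1) c m + r\<close> with \<open>r \<le> c m\<close>; for consecutive large \<open>m\<close> these intervals leave no gap.
\<close>

section \<open>Configurations in slope-intercept coordinates\<close>

definition incident :: "real \<times> real \<Rightarrow> real \<times> real \<Rightarrow> bool" where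
  "incident p l \<longleftrightarrow> snd p = fst l * fst p + snd l"

definition coord_config :: "nat \<Rightarrow> nat \<Rightarrow> (real \<times> real) set \<Rightarrow> (real \<times> real) set \<Rightarrow> bool" where
  "coord_config n k P L \<longleftrightarrow>
     finite P \<and> card P = n \<and> finite L \<and> card L = n \<and>
     (\<forall>p\<in>P. card {l \<in> L. incident p l} = k) \<and>
     (\<forall>l\<in>L. card {p \<in> P. incident p l} = k)"

lemma card_Collect_image:
  assumes "inj_on g A" and "\<And>x. x \<in> A \<Longrightarrow> Q (g x) \<longleftrightarrow> R x"
  shows "card {y \<in> g ` A. Q y} = card {x \<in> A. R x}"
proof -
  have "{y \<in> g ` A. Q y} = g ` {x \<in> A. R x}"
    using assms(2) by auto
  moreover have "inj_on g {x \<in> A. R x}"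
    using assms(1) by (rule inj_on_subset) auto
  ultimately show ?thesis
    by (simp add: card_image)
qed

lemma coord_config_image:
  assumes "coord_config n k P L" "inj_on f P" "inj_on g L"
    and "\<And>p l. p \<in> P \<Longrightarrow> l \<in> L \<Longrightarrow> incident (f p) (g l) \<longleftrightarrow> incident p l"
  shows "coord_config n k (f ` P) (g ` L)"
proof -
  have "card {l \<in> g ` L. incident (f p) l} = k" if "p \<in> P" for p
    using assms that card_Collect_image[of g L "incident (f p)" "incident p"]
    by (auto simp: coord_config_def)
  moreover have "card {p \<in> f ` P. incident p (g l)} = k" if "l \<in> L" for l
    using assms that card_Collect_image[of f P "\<lambda>p. incident p (g l)" "\<lambda>p. incident p l"]
    by (auto simp: coord_config_def)
  ultimately show ?thesis
    using assms(1-3) by (auto simp: coord_config_def card_image)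
qed

text \<open>Counting incidences in two ways gives k |P| = k |L|, and k > 0 can be cancelled. The
  constructions below therefore only count their points.\<close>

lemma coord_configI_card_points:
  assumes "finite P" "finite L" "card P = n" "k > 0"
    and "\<And>p. p \<in> P \<Longrightarrow> card {l \<in> L. incident p l} = k"
    and "\<And>l. l \<in> L \<Longrightarrow> card {p \<in> P. incident p l} = k"
  shows "coord_config n k P L"
proof -
  have "(\<Sum>p\<in>P. card {l \<in> L. incident p l}) = k * card L"
    by (rule sum_multicount) (use assms in auto)
  then have "card L = n"
    using assms(3-5) by simp
  then show ?thesis
    using assms by (simp add: coord_config_def)
qed

section \<open>Passing between lines of the plane and slope-intercept pairs\<close>

lemma is_line_eq_hyperplane:
  assumes "is_line l"
  obtains \<alpha> \<beta> \<gamma> where "\<alpha> \<noteq> 0 \<or> \<beta> \<noteq> 0" "l = {v. \<alpha> * v $ 1 + \<beta> * v $ 2 = \<gamma>}"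
proof -
  have hull: "affine hull l = l" and "aff_dim l = DIM(real ^ 2) - 1"
    using assms by (simp_all add: is_line_def)
  then have "\<exists>w \<gamma>. w \<noteq> 0 \<and> affine hull l = {v. w \<bullet> v = \<gamma>}"
    using aff_dim_eq_hyperplane by blast
  then obtain w \<gamma> where w: "w \<noteq> 0" "l = {v. w \<bullet> v = \<gamma>}"
    unfolding hull by auto
  have "w $ 1 \<noteq> 0 \<or> w $ 2 \<noteq> 0"
    using w(1) by (auto simp: vec_eq_iff forall_2)
  moreover have "l = {v. w $ 1 * v $ 1 + w $ 2 * v $ 2 = \<gamma>}"
    using w(2) by (simp add: inner_vec_def sum_2)
  ultimately show ?thesis
    by (rule that)
qed

lemma is_line_graph: "is_line {v. v $ 2 = a * v $ 1 + b}"
proof -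
  define w :: "real ^ 2" where "w = vector [- a, 1]"
  have eq: "{v :: real ^ 2. v $ 2 = a * v $ 1 + b} = {v. w \<bullet> v = b}"
    by (auto simp: w_def inner_vec_def sum_2)
  have "w \<noteq> 0"
    by (auto simp: w_def vec_eq_iff forall_2)
  then show ?thesis
    by (simp add: is_line_def eq affine_hyperplane)
qed

lemma coord_config_if_geometric:
  assumes "geometric_configuration_exists n k"
  obtains P L where "coord_config n k P L"
proof -
  obtain P L where conf: "geometric_configuration n k P L"
    using assms by (auto simp: geometric_configuration_exists_def)
  have "\<forall>l\<in>L. \<exists>\<alpha> \<beta> \<gamma>. (\<alpha> \<noteq> 0 \<or> \<beta> \<noteq> 0) \<and> l = {v. \<alpha> * v $ 1 + \<beta> * v $ 2 = \<gamma>}"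
  proof
    fix l assume "l \<in> L"
    then have "is_line l"
      using conf by (simp add: geometric_configuration_def)
    then show "\<exists>\<alpha> \<beta> \<gamma>. (\<alpha> \<noteq> 0 \<or> \<beta> \<noteq> 0) \<and> l = {v. \<alpha> * v $ 1 + \<beta> * v $ 2 = \<gamma>}"
      by (rule is_line_eq_hyperplane) blast
  qed
  then obtain \<alpha> \<beta> \<gamma> where coeffs: "\<forall>l\<in>L. (\<alpha> l \<noteq> 0 \<or> \<beta> l \<noteq> 0) \<and>
      l = {v. \<alpha> l * v $ 1 + \<beta> l * v $ 2 = \<gamma> l}"
    unfolding bchoice_iff by blast
  have nz: "\<alpha> l \<noteq> 0 \<or> \<beta> l \<noteq> 0"
    and l_eq: "l = {v. \<alpha> l * v $ 1 + \<beta> l * v $ 2 = \<gamma> l}" if "l \<in> L" for l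
    by (rule conjunct1[OF bspec[OF coeffs that]], rule conjunct2[OF bspec[OF coeffs that]])
  \<comment> \<open>The shear makes \<open>l\<close> vertical only if \<alpha> \<noteq> 0 and t =
    \<beta> / \<alpha>. For \<alpha> = 0 the quotient is 0 by convention, which merely excludes one
    more value of t.\<close>
  have "finite ((\<lambda>l. \<beta> l / \<alpha> l) ` L)"
    using conf by (simp add: geometric_configuration_def)
  from ex_new_if_finite[OF infinite_UNIV_char_0 this]
  obtain t where t: "t \<notin> (\<lambda>l. \<beta> l / \<alpha> l) ` L" ..
  \<comment> \<open>In the sheared coordinates \<open>x = v $ 1 + t * v $ 2\<close>, \<open>y = v $ 2\<close> no line of \<open>L\<close> is vertical.\<close>
  define \<delta> where "\<delta> l = \<beta> l - t * \<alpha> l" for l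
  have \<delta>: "\<delta> l \<noteq> 0" if "l \<in> L" for l
  proof
    assume 0: "\<delta> l = 0"
    show False
    proof (cases "\<alpha> l = 0")
      case True
      then show False using 0 nz[OF that] by (simp add: \<delta>_def)
    next
      case False
      then have "t = \<beta> l / \<alpha> l"
        using 0 by (simp add: \<delta>_def field_simps)
      then show False using t that by blast
    qed
  qed
  define f :: "real ^ 2 \<Rightarrow> real \<times> real" where "f v = (v $ 1 + t * v $ 2, v $ 2)" for v
  \<comment> \<open>In sheared coordinates the equation of \<open>l\<close> reads \<alpha> x +
    \<delta> y = \<gamma>; dividing by \<delta> gives slope and intercept.\<close>
  define g where "g l = (- \<alpha> l / \<delta> l, \<gamma> l / \<delta> l)" for l
  have inc: "incident (f v) (g l) \<longleftrightarrow> v \<in> l" if "l \<in> L" for l v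
  proof -
    have "incident (f v) (g l) \<longleftrightarrow> \<delta> l * v $ 2 = - \<alpha> l * (v $ 1 + t * v $ 2) + \<gamma> l"
      using \<delta>[OF that] by (simp add: incident_def f_def g_def field_simps)
    also have "\<dots> \<longleftrightarrow> \<alpha> l * v $ 1 + \<beta> l * v $ 2 = \<gamma> l"
      by (simp add: \<delta>_def algebra_simps)
    also have "\<dots> \<longleftrightarrow> v \<in> l"
      by (subst (4) l_eq[OF that]) simp
    finally show ?thesis .
  qed
  have inj_f: "inj_on f P"
    by (auto simp: inj_on_def f_def vec_eq_iff forall_2)
  have inj_g: "inj_on g L"
  proof (rule inj_onI)
    fix l l' assume "l \<in> L" "l' \<in> L" "g l = g l'"
    then have "v \<in> l \<longleftrightarrow> v \<in> l'" for v
      using inc by metis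
    then show "l = l'" by blast
  qed
  have "coord_config n k (f ` P) (g ` L)"
    using conf inj_f inj_g inc
    by (auto simp: coord_config_def geometric_configuration_def card_image
        card_Collect_image[OF inj_g, where R = "\<lambda>l. _ \<in> l"]
        card_Collect_image[OF inj_f, where R = "\<lambda>p. p \<in> _"])
  then show ?thesis
    by (rule that)
qed

lemma geometric_if_coord_config:
  assumes conf: "coord_config n k P L"
  shows "geometric_configuration_exists n k"
proof -
  define f :: "real \<times> real \<Rightarrow> real ^ 2" where "f p = vector [fst p, snd p]" for p
  define g :: "real \<times> real \<Rightarrow> (real ^ 2) set" where
    "g l = {v. v $ 2 = fst l * v $ 1 + snd l}" for l
  have inc: "f p \<in> g l \<longleftrightarrow> incident p l" for p l
    by (simp add: f_def g_def incident_def)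
  have inj_f: "inj_on f P"
    by (auto simp: inj_on_def f_def vec_eq_iff forall_2 prod_eq_iff)
  have inj_g: "inj_on g L"
  proof (rule inj_onI)
    fix l l' assume "g l = g l'"
    then have "incident p l \<longleftrightarrow> incident p l'" for p
      using inc by metis
    \<comment> \<open>The points of \<open>l\<close> at abscissas 0 and 1 determine its intercept
      and slope.\<close>
    from this[of "(0, snd l)"] this[of "(1, fst l + snd l)"] show "l = l'"
      by (simp add: incident_def prod_eq_iff)
  qed
  have "is_line (g l)" for l
    unfolding g_def by (rule is_line_graph)
  then have "geometric_configuration n k (f ` P) (g ` L)"
    using conf inj_f inj_g inc
    by (auto simp: coord_config_def geometric_configuration_def card_image
        card_Collect_image[OF inj_g, where R = "incident _"]
        card_Collect_image[OF inj_f, where R = "\<lambda>p. incident p _"])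
  then show ?thesis
    by (auto simp: geometric_configuration_exists_def)
qed

section \<open>Generic parameters and general position\<close>

text \<open>Greedy choice: each new parameter has to avoid \<open>F\<close>, the earlier ones and
  the finitely many values in conflict with them. Symmetry of \<open>B\<close> makes checking one
  direction enough.\<close>

lemma ex_card_pairwise_avoiding:
  fixes F :: "real set"
  assumes "finite F" and "\<And>c. c \<notin> F \<Longrightarrow> finite {d. B c d}"
    and "\<And>c d. B c d \<Longrightarrow> B d c"
  obtains C where "finite C" "card C = n" "C \<inter> F = {}"
    "\<And>c d. c \<in> C \<Longrightarrow> d \<in> C \<Longrightarrow> c \<noteq> d \<Longrightarrow> \<not> B c d"
proof -
  have "\<exists>C. finite C \<and> card C = n \<and> C \<inter> F = {} \<and> (\<forall>c\<in>C. \<forall>d\<in>C. c \<noteq> d \<longrightarrow> \<not> B c d)"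
  proof (induction n)
    case 0
    show ?case by (intro exI[of _ "{}"]) auto
  next
    case (Suc n)
    then obtain C where C: "finite C" "card C = n" "C \<inter> F = {}"
      "\<forall>c\<in>C. \<forall>d\<in>C. c \<noteq> d \<longrightarrow> \<not> B c d"
      by blast
    have "finite (F \<union> C \<union> (\<Union>c\<in>C. {d. B c d}))"
      using C assms(1,2) by auto
    from ex_new_if_finite[OF infinite_UNIV_char_0 this]
    obtain d where d: "d \<notin> F \<union> C \<union> (\<Union>c\<in>C. {d. B c d})" ..
    then have "finite (insert d C) \<and> card (insert d C) = Suc n \<and> insert d C \<inter> F = {} \<and>
        (\<forall>c\<in>insert d C. \<forall>e\<in>insert d C. c \<noteq> e \<longrightarrow> \<not> B c e)"
      using C assms(3) by auto
    then show ?case by blast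
  qed
  then show ?thesis
    using that by blast
qed

lemma finite_quadratic_roots:
  fixes u v w :: real
  assumes "u \<noteq> 0 \<or> v \<noteq> 0 \<or> w \<noteq> 0"
  shows "finite {x. u + v * x + w * x\<^sup>2 = 0}"
proof -
  have "[:u, v, w:] \<noteq> 0"
    using assms by auto
  from poly_roots_finite[OF this] show ?thesis
    by (simp add: algebra_simps power2_eq_square)
qed

text \<open>Under (x, y) \<mapsto> (x + s, y + t x) the line y = a x + b becomes y = (a + t) (x - s)
  + b.\<close>

lemma coord_config_shear_translate:
  assumes "coord_config n k P L"
  shows "coord_config n k ((\<lambda>p. (fst p + s, snd p + t * fst p)) ` P)
    ((\<lambda>l. (fst l + t, snd l - s * (fst l + t))) ` L)"
  by (rule coord_config_image[OF assms])
    (auto simp: inj_on_def prod_eq_iff incident_def algebra_simps)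

text \<open>A shear by t makes all slopes nonzero and all heights of points distinct. A translation
  by s then leaves slopes and heights alone, and makes abscissas nonzero, intercepts distinct and no
  intercept equal to a height.\<close>

lemma coord_config_general_position:
  assumes conf: "coord_config n k P L"
  obtains P' L' where "coord_config n k P' L'" "\<And>p. p \<in> P' \<Longrightarrow> fst p \<noteq> 0" "\<And>l. l \<in> L' \<Longrightarrow> fst l \<noteq> 0"
    "inj_on snd P'" "inj_on snd L'" "\<And>p l. p \<in> P' \<Longrightarrow> l \<in> L' \<Longrightarrow> snd p \<noteq> snd l"
proof -
  have fin: "finite P" "finite L"
    using conf by (auto simp: coord_config_def)
  define T where "T = (\<lambda>l. - fst l) ` L \<union> (\<lambda>(p, q). (snd q - snd p) / (fst p - fst q)) ` (P \<times> P)"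
  have "finite T"
    using fin by (simp add: T_def)
  from ex_new_if_finite[OF infinite_UNIV_char_0 this]
  obtain t where t: "t \<notin> T" ..
  \<comment> \<open>The excluded values solve, in turn: abscissa zero, two equal intercepts,
    intercept equal to height. The last is solvable for s because the sheared slope
    \<open>fst l + t\<close> is nonzero.\<close>
  define S where "S = (\<lambda>p. - fst p) ` P \<union> (\<lambda>(l, m). (snd l - snd m) / (fst l - fst m)) ` (L \<times> L)
    \<union> (\<lambda>(p, l). (snd l - snd p - t * fst p) / (fst l + t)) ` (P \<times> L)"
  have "finite S"
    using fin by (simp add: S_def)
  from ex_new_if_finite[OF infinite_UNIV_char_0 this]
  obtain s where s: "s \<notin> S" ..
  let ?f = "\<lambda>p. (fst p + s, snd p + t * fst p)"
  let ?g = "\<lambda>l. (fst l + t, snd l - s * (fst l + t))"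
  have lt: "fst l + t \<noteq> 0" if "l \<in> L" for l
    using t that by (auto simp: T_def eq_neg_iff_add_eq_0 add.commute)
  have ps: "fst p + s \<noteq> 0" if "p \<in> P" for p
    using s that by (auto simp: S_def eq_neg_iff_add_eq_0 add.commute)
  have inj_P: "p = q" if "p \<in> P" "q \<in> P" "snd p + t * fst p = snd q + t * fst q" for p q
  proof (cases "fst p = fst q")
    case True
    then show ?thesis using that by (simp add: prod_eq_iff)
  next
    case False
    then have "t = (snd q - snd p) / (fst p - fst q)"
      using that(3) by (simp add: field_simps)
    then have "t \<in> T"
      using that by (auto simp: T_def)
    with t show ?thesis by simp
  qed
  have inj_L: "l = m" if "l \<in> L" "m \<in> L" "snd l - s * (fst l + t) = snd m - s * (fst m + t)" for l m
  proof (cases "fst l = fst m")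
    case True
    then show ?thesis using that by (simp add: prod_eq_iff)
  next
    case False
    then have "s = (snd l - snd m) / (fst l - fst m)"
      using that(3) by (simp add: field_simps)
    then have "s \<in> S"
      using that by (auto simp: S_def)
    with s show ?thesis by simp
  qed
  have ne: "snd p + t * fst p \<noteq> snd l - s * (fst l + t)" if "p \<in> P" "l \<in> L" for p l
  proof
    assume "snd p + t * fst p = snd l - s * (fst l + t)"
    then have "s = (snd l - snd p - t * fst p) / (fst l + t)"
      using lt[OF that(2)] by (simp add: field_simps)
    then have "s \<in> S"
      using that by (auto simp: S_def)
    with s show False by simp
  qed
  show ?thesis
  proof
    show "coord_config n k (?f ` P) (?g ` L)"
      by (rule coord_config_shear_translate[OF conf])
    show "inj_on snd (?f ` P)"
      using inj_P by (fastforce intro!: inj_onI)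
    show "inj_on snd (?g ` L)"
      using inj_L by (fastforce intro!: inj_onI)
  qed (use lt ps ne in auto)
qed

section \<open>Affine replication\<close>

text \<open>There are (k + 1) m image points and m points on the axis. An image point or line gains
  one new incidence to its k old ones; an axis point or a new horizontal line meets the k + 1 images
  of one line or point. \<open>H\<close> collects the heights of the horizontal lines, for use in
  the switch.\<close>

lemma affine_replication:
  assumes "coord_config m k P0 L0"
  obtains P' L' H where "coord_config ((k + 2) * m) (Suc k) P' L'"
    "finite H" "card H = m" "Pair 0 ` H \<subseteq> L'"
proof -
  obtain P L where conf: "coord_config m k P L"
    and P0: "\<And>p. p \<in> P \<Longrightarrow> fst p \<noteq> 0" and L0: "\<And>l. l \<in> L \<Longrightarrow> fst l \<noteq> 0"
    and injP: "inj_on snd P" and injL: "inj_on snd L"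
    and PL: "\<And>p l. p \<in> P \<Longrightarrow> l \<in> L \<Longrightarrow> snd p \<noteq> snd l"
    using coord_config_general_position[OF assms] by blast
  have fin: "finite P" "finite L" and cards: "card P = m" "card L = m"
    using conf by (auto simp: coord_config_def)
  \<comment> \<open>\<open>B0 c d\<close>: an image of a point under c lies on an image of a line
    under d, with the denominator d cleared. With c fixed, general position keeps this linear
    equation in d nontrivial, and likewise the one from \<open>B0 d c\<close>.\<close>
  define B0 where "B0 c d \<longleftrightarrow> (\<exists>p\<in>P. \<exists>l\<in>L. d * (snd p - snd l) = c * (fst l * fst p))" for c d
  have "finite {d. B0 c d \<or> B0 d c}" if "c \<notin> {0}" for c
  proof -
    have "finite {d. d * (snd p - snd l) = c * (fst l * fst p)}" if "p \<in> P" "l \<in> L" for p l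
      using finite_quadratic_roots[of "- c * (fst l * fst p)" "snd p - snd l" 0] \<open>c \<notin> {0}\<close>
        P0[OF that(1)] L0[OF that(2)]
      by (simp add: algebra_simps)
    moreover have "finite {d. c * (snd p - snd l) = d * (fst l * fst p)}" if "p \<in> P" "l \<in> L" for p l
      using finite_quadratic_roots[of "c * (snd p - snd l)" "- fst l * fst p" 0]
        P0[OF that(1)] L0[OF that(2)]
      by (simp add: algebra_simps)
    ultimately show ?thesis
      using fin by (simp add: B0_def)
  qed
  then obtain C where C: "finite C" "card C = Suc k" "C \<inter> {0} = {}"
    and CB: "\<And>c d. c \<in> C \<Longrightarrow> d \<in> C \<Longrightarrow> c \<noteq> d \<Longrightarrow> \<not> (B0 c d \<or> B0 d c)"
    using ex_card_pairwise_avoiding[of "{0}" "\<lambda>c d. B0 c d \<or> B0 d c" "Suc k"] by blast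
  have C0: "c \<noteq> 0" if "c \<in> C" for c
    using C(3) that by auto
  define f where "f c p = (c * fst p, snd p)" for c :: real and p :: "real \<times> real"
  define g where "g c l = (fst l / c, snd l)" for c :: real and l :: "real \<times> real"
  \<comment> \<open>\<open>pt\<close> has two readings: for a line it is the point where all its
    images meet the axis, for a point it encodes the horizontal line (slope 0) through all its
    images.\<close>
  define pt where "pt l = (0 :: real, snd l)" for l :: "real \<times> real"
  have inc_fg: "incident (f c p) (g d l) \<longleftrightarrow> c = d \<and> incident p l"
    if "c \<in> C" "d \<in> C" "p \<in> P" "l \<in> L" for c d p l
  proof (cases "c = d")
    case True
    then show ?thesis
      using C0[OF that(2)] by (simp add: incident_def f_def g_def)
  next
    case False
    then have "d * (snd p - snd l) \<noteq> c * (fst l * fst p)"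
      using CB[OF that(1,2)] that by (auto simp: B0_def)
    then show ?thesis
      using C0[OF that(2)] False by (simp add: incident_def f_def g_def field_simps)
  qed
  have inc_f: "incident (f c p) (pt q) \<longleftrightarrow> p = q" if "p \<in> P" "q \<in> P" for c p q
    using injP that by (auto simp: incident_def f_def pt_def inj_on_def)
  have inc_g: "incident (pt l) (g c m) \<longleftrightarrow> l = m" if "l \<in> L" "m \<in> L" for c l m
    using injL that by (auto simp: incident_def g_def pt_def inj_on_def)
  have inc_pt: "\<not> incident (pt l) (pt p)" if "p \<in> P" "l \<in> L" for p l
    using PL[OF that] by (simp add: incident_def pt_def)
  have f_eq: "f c p = f d q \<longleftrightarrow> c = d \<and> p = q" if "p \<in> P" "q \<in> P" for c d p q
    using injP that P0[OF that(1)] P0[OF that(2)] by (auto simp: f_def inj_on_def)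
  have g_eq: "g c l = g d m \<longleftrightarrow> c = d \<and> l = m"
    if "c \<in> C" "d \<in> C" "l \<in> L" "m \<in> L" for c d l m
    using injL that L0[OF that(3)] L0[OF that(4)] C0[OF that(1)] C0[OF that(2)]
    by (auto simp: g_def inj_on_def)
  have f_pt: "f c p \<noteq> pt l" if "c \<in> C" "p \<in> P" for c p l
    using C0[OF that(1)] P0[OF that(2)] by (simp add: f_def pt_def)
  have g_pt: "g c l \<noteq> pt p" if "c \<in> C" "l \<in> L" for c p l
    using C0[OF that(1)] L0[OF that(2)] by (simp add: g_def pt_def)
  have inj_ptL: "inj_on pt L"
    using injL by (auto simp: pt_def inj_on_def)
  define P' where "P' = case_prod f ` (C \<times> P) \<union> pt ` L"
  define L' where "L' = case_prod g ` (C \<times> L) \<union> pt ` P"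
  have inj_f: "inj_on (case_prod f) (C \<times> P)"
    using f_eq by (auto simp: inj_on_def)
  have inj_fc: "inj_on (\<lambda>c. f c p) C" if "p \<in> P" for p
    using f_eq that by (auto simp: inj_on_def)
  have inj_gc: "inj_on (\<lambda>c. g c l) C" if "l \<in> L" for l
    using g_eq that by (auto simp: inj_on_def)
  have card_P': "card P' = (k + 2) * m"
  proof -
    have "card P' = card (case_prod f ` (C \<times> P)) + card (pt ` L)"
      unfolding P'_def by (rule card_Un_disjoint) (use C(1) fin f_pt f_pt[symmetric] in auto)
    then show ?thesis
      by (simp add: card_image[OF inj_f] card_image[OF inj_ptL] card_cartesian_product C(2) cards)
  qed
  have deg_f: "card {l \<in> L'. incident (f c p) l} = Suc k" if "c \<in> C" "p \<in> P" for c p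
  proof -
    have "{l \<in> L'. incident (f c p) l} = insert (pt p) (g c ` {l \<in> L. incident p l})"
      using that by (auto simp: L'_def inc_fg inc_f)
    moreover have "pt p \<notin> g c ` {l \<in> L. incident p l}"
      using g_pt that by (metis (no_types, lifting) imageE mem_Collect_eq)
    moreover have "inj_on (g c) {l \<in> L. incident p l}"
      using g_eq that by (auto simp: inj_on_def)
    ultimately show ?thesis
      using conf that fin by (simp add: card_image coord_config_def)
  qed
  have deg_ptL: "card {m \<in> L'. incident (pt l) m} = Suc k" if "l \<in> L" for l
  proof -
    have "{m \<in> L'. incident (pt l) m} = (\<lambda>c. g c l) ` C"
      using that by (auto simp: L'_def inc_g inc_pt)
    then show ?thesis
      using inj_gc[OF that] C(2) by (simp add: card_image)
  qed
  have deg_g: "card {p \<in> P'. incident p (g c l)} = Suc k" if "c \<in> C" "l \<in> L" for c l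
  proof -
    have "{p \<in> P'. incident p (g c l)} = insert (pt l) (f c ` {p \<in> P. incident p l})"
      using that by (auto simp: P'_def inc_fg inc_g)
    moreover have "pt l \<notin> f c ` {p \<in> P. incident p l}"
      using f_pt that by (metis (no_types, lifting) imageE mem_Collect_eq)
    moreover have "inj_on (f c) {p \<in> P. incident p l}"
      using f_eq that by (auto simp: inj_on_def)
    ultimately show ?thesis
      using conf that fin by (simp add: card_image coord_config_def)
  qed
  have deg_ptP: "card {q \<in> P'. incident q (pt p)} = Suc k" if "p \<in> P" for p
  proof -
    have "{q \<in> P'. incident q (pt p)} = (\<lambda>c. f c p) ` C"
      using that by (auto simp: P'_def inc_f inc_pt)
    then show ?thesis
      using inj_fc[OF that] C(2) by (simp add: card_image)
  qed
  show ?thesis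
  proof
    show "coord_config ((k + 2) * m) (Suc k) P' L'"
    proof (rule coord_configI_card_points)
      show "finite P'" "finite L'"
        using fin C(1) by (auto simp: P'_def L'_def)
      show "card {l \<in> L'. incident p l} = Suc k" if "p \<in> P'" for p
        using that deg_f deg_ptL unfolding P'_def by auto
      show "card {p \<in> P'. incident p l} = Suc k" if "l \<in> L'" for l
        using that deg_g deg_ptP unfolding L'_def by auto
    qed (simp_all add: card_P')
    show "finite (snd ` P)" "card (snd ` P) = m"
      using fin cards injP by (auto simp: card_image)
    show "Pair 0 ` snd ` P \<subseteq> L'"
      by (auto simp: L'_def pt_def image_iff)
  qed
qed

section \<open>Affine switch\<close>

text \<open>Degrees survive the exchange: an image of a point on y = h trades the image of that line
  for one new line, a new line carries k - 1 images and (0, h), and (0, h) lies on one new line for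
  each of the k points of y = h.\<close>

lemma affine_switch:
  assumes conf0: "coord_config M k P0 L0" and H0: "finite H" "Pair 0 ` H \<subseteq> L0"
    and k: "k > 0"
  obtains P' L' where "coord_config ((k - 1) * M + card H) k P' L'"
proof -
  have "finite ((\<lambda>p. - fst p) ` P0)"
    using conf0 by (simp add: coord_config_def)
  from ex_new_if_finite[OF infinite_UNIV_char_0 this]
  obtain s where s: "s \<notin> (\<lambda>p. - fst p) ` P0" ..
  \<comment> \<open>A horizontal translation (shear parameter 0) makes all abscissas nonzero and
    fixes every line y = h.\<close>
  define P where "P = (\<lambda>p. (fst p + s, snd p + 0 * fst p)) ` P0"
  define L where "L = (\<lambda>l. (fst l + 0, snd l - s * (fst l + 0))) ` L0"
  have conf: "coord_config M k P L"
    unfolding P_def L_def by (rule coord_config_shear_translate[OF conf0])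
  have P0: "fst p \<noteq> 0" if "p \<in> P" for p
    using that s by (force simp: P_def image_iff eq_neg_iff_add_eq_0 add.commute)
  have HL: "(0, h) \<in> L" if "h \<in> H" for h
    using H0(2) that by (force simp: L_def)
  have fin: "finite P" "finite L" and card_P: "card P = M"
    using conf by (auto simp: coord_config_def)
  \<comment> \<open>The conflicts between two maps: images of points at equal height, images of
    lines with equal intercept, and an image of a point under c on an image of a line under
    d.\<close>
  define B0 where "B0 c d \<longleftrightarrow>
    (\<exists>p\<in>P. \<exists>q\<in>P. snd p + c = snd q + d) \<or> (\<exists>l\<in>L. \<exists>m\<in>L. snd l + c = snd m + d) \<or>
    (\<exists>p\<in>P. \<exists>l\<in>L. d * (snd p + c - snd l - d) = c * (fst l * fst p))" for c d
  \<comment> \<open>Values bad for a single map: 0; those making the equation of \<open>3\<close>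
    below degenerate in d; those putting an image of \<open>p\<close> on \<open>j q\<close>; those
    putting (0, h) on an image of \<open>l\<close>; those giving \<open>j p\<close> and an image of
    \<open>l\<close> the same intercept.\<close>
  define F where "F = insert 0 ((\<lambda>(l, p). fst l * fst p) ` (L \<times> P)
    \<union> (\<lambda>(p, q). fst q * (snd q - snd p) / (fst q - fst p)) ` (P \<times> P)
    \<union> (\<lambda>(h, l). h - snd l) ` (H \<times> L) \<union> (\<lambda>(p, l). snd p - snd l) ` (P \<times> L))"
  have "finite F"
    using fin H0(1) by (simp add: F_def)
  moreover have "finite {d. B0 c d \<or> B0 d c}" if "c \<notin> F" for c
  proof -
    have 1: "finite {d. u + c = v + d}" "finite {d. v + d = u + c}" for u v :: real
      by (rule finite_subset[of _ "{u + c - v}"]; auto)+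
    \<comment> \<open>A quadratic in d with leading coefficient -1, hence never trivial.\<close>
    have 2: "finite {d. d * (snd p + c - snd l - d) = c * (fst l * fst p)}" for p l
    proof -
      have "d * (snd p + c - snd l - d) = c * (fst l * fst p) \<longleftrightarrow>
        - c * (fst l * fst p) + (snd p + c - snd l) * d + (- 1) * d\<^sup>2 = 0" for d
        by (simp add: algebra_simps power2_eq_square)
      then show ?thesis
        using finite_quadratic_roots[of "- c * (fst l * fst p)" "snd p + c - snd l" "- 1"] by simp
    qed
    have 3: "finite {d. c * (snd p + d - snd l - c) = d * (fst l * fst p)}"
      if "p \<in> P" "l \<in> L" for p l
    proof -
      have "c \<noteq> fst l * fst p"
        using \<open>c \<notin> F\<close> that by (force simp: F_def)
      moreover have "c * (snd p + d - snd l - c) = d * (fst l * fst p) \<longleftrightarrow>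
        c * (snd p - snd l - c) + (c - fst l * fst p) * d + 0 * d\<^sup>2 = 0" for d
        by (auto simp: algebra_simps)
      ultimately show ?thesis
        using finite_quadratic_roots[of "c * (snd p - snd l - c)" "c - fst l * fst p" 0] by simp
    qed
    show ?thesis
      using fin 1 2 3 by (simp add: B0_def)
  qed
  ultimately obtain C where C: "finite C" "card C = k - 1" "C \<inter> F = {}"
    and CB: "\<And>c d. c \<in> C \<Longrightarrow> d \<in> C \<Longrightarrow> c \<noteq> d \<Longrightarrow> \<not> (B0 c d \<or> B0 d c)"
    using ex_card_pairwise_avoiding[of F "\<lambda>c d. B0 c d \<or> B0 d c" "k - 1"] by blast
  have CF: "c \<notin> F" if "c \<in> C" for c
    using C(3) that by auto
  have C0: "c \<noteq> 0" if "c \<in> C" for c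
    using CF[OF that] by (auto simp: F_def)
  define f where "f c p = (c * fst p, snd p + c)" for c :: real and p :: "real \<times> real"
  define g where "g c l = (fst l / c, snd l + c)" for c :: real and l :: "real \<times> real"
  define j where "j p = (1 / fst p, snd p)" for p :: "real \<times> real"
  have inc_fg: "incident (f c p) (g d l) \<longleftrightarrow> c = d \<and> incident p l"
    if "c \<in> C" "d \<in> C" "p \<in> P" "l \<in> L" for c d p l
  proof (cases "c = d")
    case True
    then show ?thesis
      using C0[OF that(2)] by (simp add: incident_def f_def g_def)
  next
    case False
    then have ne: "d * (snd p + c - snd l - d) \<noteq> c * (fst l * fst p)"
      using CB[OF that(1,2)] that by (auto simp: B0_def)
    have "incident (f c p) (g d l) \<longleftrightarrow> d * (snd p + c - snd l - d) = c * (fst l * fst p)"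
      using C0[OF that(2)] by (simp add: incident_def f_def g_def field_simps)
    with ne False show ?thesis by simp
  qed
  \<comment> \<open>The images of \<open>p\<close> on the line \<open>y = h\<close> all lie on a line through \<open>(0, h)\<close>, namely \<open>j p\<close>.\<close>
  have inc_fj: "incident (f c p) (j q) \<longleftrightarrow> p = q" if "c \<in> C" "p \<in> P" "q \<in> P" for c p q
  proof (cases "fst p = fst q")
    case True
    then show ?thesis
      using P0[OF that(3)] by (auto simp: incident_def f_def j_def prod_eq_iff)
  next
    case False
    have "c \<noteq> fst q * (snd q - snd p) / (fst q - fst p)"
      using CF[OF that(1)] that by (force simp: F_def)
    then show ?thesis
      using False P0[OF that(3)] by (auto simp: incident_def f_def j_def field_simps)
  qed
  have inc_hg: "\<not> incident (0, h) (g c l)" if "h \<in> H" "c \<in> C" "l \<in> L" for h c l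
  proof -
    have "c \<noteq> h - snd l"
      using CF[OF that(2)] that by (force simp: F_def)
    then show ?thesis
      by (auto simp: incident_def g_def)
  qed
  have inc_hj: "incident (0, h) (j p) \<longleftrightarrow> snd p = h" for h p
    by (auto simp: incident_def j_def)
  have f_eq: "f c p = f d q \<longleftrightarrow> c = d \<and> p = q"
    if "c \<in> C" "d \<in> C" "p \<in> P" "q \<in> P" for c d p q
  proof (cases "c = d")
    case True
    then show ?thesis
      using C0[OF that(1)] by (auto simp: f_def prod_eq_iff)
  next
    case False
    then have "snd p + c \<noteq> snd q + d"
      using CB[OF that(1,2)] that unfolding B0_def by blast
    with False show ?thesis
      by (simp add: f_def)
  qed
  have g_eq: "g c l = g d m \<longleftrightarrow> c = d \<and> l = m"
    if "c \<in> C" "d \<in> C" "l \<in> L" "m \<in> L" for c d l m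
  proof (cases "c = d")
    case True
    then show ?thesis
      using C0[OF that(1)] by (auto simp: g_def prod_eq_iff)
  next
    case False
    then have "snd l + c \<noteq> snd m + d"
      using CB[OF that(1,2)] that unfolding B0_def by blast
    with False show ?thesis
      by (simp add: g_def)
  qed
  have j_eq: "j p = j q \<longleftrightarrow> p = q" if "p \<in> P" "q \<in> P" for p q
    using P0[OF that(1)] P0[OF that(2)] by (auto simp: j_def prod_eq_iff)
  have f_h: "f c p \<noteq> (0, h)" if "c \<in> C" "p \<in> P" for c p h
    using C0[OF that(1)] P0[OF that(2)] by (simp add: f_def)
  have g_j: "g c l \<noteq> j p" if "c \<in> C" "l \<in> L" "p \<in> P" for c l p
  proof -
    have "c \<noteq> snd p - snd l"
      using CF[OF that(1)] that by (force simp: F_def)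
    then show ?thesis
      by (auto simp: g_def j_def)
  qed
  define PH where "PH = {p \<in> P. snd p \<in> H}"
  define R where "R = L - Pair 0 ` H"
  define P' where "P' = case_prod f ` (C \<times> P) \<union> Pair 0 ` H"
  define L' where "L' = case_prod g ` (C \<times> R) \<union> j ` PH"
  have RL: "R \<subseteq> L"
    by (auto simp: R_def)
  have RD: "l \<in> R \<Longrightarrow> l \<in> L" for l
    using RL by blast
  have inj_f: "inj_on (case_prod f) (C \<times> P)"
    using f_eq by (auto simp: inj_on_def)
  have card_P': "card P' = (k - 1) * M + card H"
  proof -
    have "card P' = card (case_prod f ` (C \<times> P)) + card (Pair (0 :: real) ` H)"
      unfolding P'_def by (rule card_Un_disjoint) (use C(1) fin H0(1) f_h f_h[symmetric] in auto)
    then show ?thesis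
      by (simp add: card_image[OF inj_f] card_image[of "Pair (0 :: real)"] inj_on_def
          card_cartesian_product C(2) card_P)
  qed
  have deg_f: "card {l \<in> L'. incident (f c p) l} = k" if "c \<in> C" "p \<in> P" for c p
  proof -
    have inj: "inj_on (g c) {l \<in> R. incident p l}"
      using g_eq that RD by (auto simp: inj_on_def)
    have deg: "card {l \<in> L. incident p l} = k"
      using conf that by (simp add: coord_config_def)
    show ?thesis
    proof (cases "snd p \<in> H")
      case True
      then have "{l \<in> L'. incident (f c p) l} = insert (j p) (g c ` {l \<in> R. incident p l})"
        using that RD by (auto simp: L'_def inc_fg inc_fj PH_def)
      moreover have "j p \<notin> g c ` {l \<in> R. incident p l}"
        using g_j[OF that(1) RD that(2)] by fastforce
      ultimately have "card {l \<in> L'. incident (f c p) l} = Suc (card {l \<in> R. incident p l})"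
        using inj fin RL by (simp add: card_image finite_subset)
      \<comment> \<open>Exactly one line through \<open>p\<close> is removed, the horizontal one,
        and \<open>j p\<close> makes up for it.\<close>
      also have "{l \<in> L. incident p l} = insert (0, snd p) {l \<in> R. incident p l}"
        using True HL by (auto simp: R_def incident_def)
      then have "Suc (card {l \<in> R. incident p l}) = card {l \<in> L. incident p l}"
        using True fin RL by (simp add: R_def)
      finally show ?thesis
        using deg by simp
    next
      case False
      then have "{l \<in> L'. incident (f c p) l} = g c ` {l \<in> R. incident p l}"
        using that RD by (auto simp: L'_def inc_fg inc_fj PH_def)
      moreover have "{l \<in> R. incident p l} = {l \<in> L. incident p l}"
        using False by (auto simp: R_def incident_def)
      ultimately show ?thesis
        using inj deg by (simp add: card_image)
    qed
  qed
  have deg_h: "card {l \<in> L'. incident (0, h) l} = k" if "h \<in> H" for h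
  proof -
    have "{l \<in> L'. incident (0, h) l} = j ` {p \<in> P. incident p (0, h)}"
      using that RD inc_hg by (auto simp: L'_def inc_hj PH_def incident_def[of _ "(0, h)"])
    moreover have "inj_on j {p \<in> P. incident p (0, h)}"
      using j_eq by (auto simp: inj_on_def)
    ultimately show ?thesis
      using conf HL[OF that] by (simp add: card_image coord_config_def)
  qed
  have deg_g: "card {p \<in> P'. incident p (g c l)} = k" if "c \<in> C" "l \<in> R" for c l
  proof -
    have l: "l \<in> L"
      using that RL by auto
    then have "{p \<in> P'. incident p (g c l)} = f c ` {p \<in> P. incident p l}"
      using that inc_hg[OF _ that(1) l] by (auto simp: P'_def inc_fg)
    moreover have "inj_on (f c) {p \<in> P. incident p l}"
      using f_eq that by (auto simp: inj_on_def)
    ultimately show ?thesis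
      using conf l by (simp add: card_image coord_config_def)
  qed
  have deg_j: "card {q \<in> P'. incident q (j p)} = k" if "p \<in> PH" for p
  proof -
    have p: "p \<in> P" "snd p \<in> H"
      using that by (auto simp: PH_def)
    then have "{q \<in> P'. incident q (j p)} = insert (0, snd p) ((\<lambda>c. f c p) ` C)"
      by (auto simp: P'_def inc_fj inc_hj)
    moreover have "(0, snd p) \<notin> (\<lambda>c. f c p) ` C"
      using f_h[OF _ p(1)] by (metis imageE)
    moreover have "inj_on (\<lambda>c. f c p) C"
      using f_eq p(1) by (auto simp: inj_on_def)
    ultimately show ?thesis
      using C k by (simp add: card_image)
  qed
  have "coord_config ((k - 1) * M + card H) k P' L'"
  proof (rule coord_configI_card_points)
    show "finite P'" "finite L'"
      using fin C(1) H0(1) by (auto simp: P'_def L'_def R_def PH_def)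
    show "card {l \<in> L'. incident p l} = k" if "p \<in> P'" for p
      using that deg_f deg_h unfolding P'_def by auto
    show "card {p \<in> P'. incident p l} = k" if "l \<in> L'" for l
      using that deg_g deg_j unfolding L'_def by auto
  qed (simp_all add: card_P' k)
  then show ?thesis
    by (rule that)
qed

section \<open>Sizes reached by replication and switch\<close>

text \<open>The step from k to k + 1 multiplies the size by k + 2, so the factors form the product
  (t + 2) ... (k + 1).\<close>

lemma coord_config_iterated_replication:
  assumes "\<exists>P L. coord_config m t P L" and "t \<le> k"
  shows "\<exists>P L. coord_config (fact (k + 1) div fact (t + 1) * m) k P L"
  using assms(2)
proof (induction k rule: dec_induct)
  case base
  then show ?case using assms(1) by simp
next
  case (step k)
  then obtain P L where "coord_config (fact (k + 1) div fact (t + 1) * m) k P L"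
    by blast
  then obtain P' L' where
    "coord_config ((k + 2) * (fact (k + 1) div fact (t + 1) * m)) (Suc k) P' L'"
    by (rule affine_replication)
  moreover have "(k + 2) * (fact (k + 1) div fact (t + 1)) = (fact (Suc k + 1) div fact (t + 1) :: nat)"
  proof -
    have "(fact (t + 1) :: nat) dvd fact (k + 1)"
      by (rule fact_dvd) (use step.hyps in simp)
    then have "(k + 2) * (fact (k + 1) div fact (t + 1)) = (k + 2) * fact (k + 1) div (fact (t + 1) :: nat)"
      by (rule div_mult_swap)
    also have "(k + 2) * fact (k + 1) = (fact (Suc k + 1) :: nat)"
      by (simp add: algebra_simps)
    finally show ?thesis .
  qed
  ultimately show ?case
    by (metis mult.assoc)
qed

text \<open>Replication up to k - 1 gives size m' = c m with c = k! / (t + 1)!. One more replication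
  gives (k + 1) m' points and m' horizontal lines; switching r of these gives (k - 1) (k + 1) m' +
  r.\<close>

lemma geometric_configuration_exists_replication_switch:
  assumes conf: "geometric_configuration_exists m t" and t: "t < k"
    and r: "r \<le> fact k div fact (t + 1) * m"
  shows "geometric_configuration_exists ((k\<^sup>2 - 1) * (fact k div fact (t + 1) * m) + r) k"
proof -
  define m' where "m' = fact k div fact (t + 1) * m"
  have "\<exists>P L. coord_config m' (k - 1) P L"
    using coord_config_iterated_replication[of m t "k - 1"] coord_config_if_geometric[OF conf] t
    unfolding m'_def by (metis Suc_eq_plus1 Suc_pred' less_Suc_eq_le less_nat_zero_code not_gr_zero)
  then obtain P L where PL: "coord_config m' (k - 1) P L" by blast
  have k: "k - 1 + 2 = k + 1" "Suc (k - 1) = k"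
    using t by simp_all
  then obtain P' L' H where 1: "coord_config ((k + 1) * m') k P' L'"
    "finite H" "card H = m'" "Pair 0 ` H \<subseteq> L'"
    using affine_replication[OF PL] unfolding k by blast
  obtain H' where H': "H' \<subseteq> H" "card H' = r" "finite H'"
    using obtain_subset_with_card_n[of r H] 1(3) r unfolding m'_def by metis
  then have "Pair 0 ` H' \<subseteq> L'" "0 < k"
    using 1(4) t by auto
  then obtain P'' L'' where "coord_config ((k - 1) * ((k + 1) * m') + r) k P'' L''"
    using affine_switch[OF 1(1) H'(3)] unfolding H'(2) by blast
  moreover have "(k - 1) * (k + 1) = k\<^sup>2 - 1"
    by (simp add: power2_eq_square algebra_simps)
  ultimately show ?thesis
    unfolding m'_def[symmetric] by (metis geometric_if_coord_config mult.assoc)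
qed

text \<open>Divide n by D c, where D = k^2 - 1: the quotient m is the size of the initial
  configuration and the remainder r the number of switched lines. The bound makes m large enough for
  r \<le> c m.\<close>

lemma geometric_configuration_exists_N_bound:
  assumes conf: "\<And>m. m \<ge> a \<Longrightarrow> geometric_configuration_exists m t"
    and t: "t < k" "0 < t" and n: "n \<ge> N_bound k t a 1"
  shows "geometric_configuration_exists n k"
proof -
  define D where "D = k\<^sup>2 - 1"
  define c :: nat where "c = fact k div fact (t + 1)"
  define m0 where "m0 = (if t < k - 1 then max a D else max a (D - 1))"
  have c: "c > 0"
    using t by (simp add: c_def div_greater_zero_iff fact_mono del: fact_Suc)
  have c1: "c = 1" if "\<not> t < k - 1"
  proof -
    have "k = t + 1"
      using that t by linarith
    then show ?thesis
      by (simp add: c_def del: fact_Suc)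
  qed
  have "1 * 1 < k * k"
    by (intro mult_strict_mono) (use t in auto)
  then have D: "D > 0"
    by (simp add: D_def power2_eq_square)
  have "N_bound k t a 1 = D * c * m0"
    unfolding N_bound_def m0_def mult_1_right D_def[symmetric] c_def[symmetric]
    using c1 by simp
  then have "n div (D * c) \<ge> m0"
    using n c D by (simp add: less_eq_div_iff_mult_less_eq mult.commute)
  define m where "m = n div (D * c)"
  define r where "r = n mod (D * c)"
  have m: "m \<ge> m0"
    unfolding m_def by fact
  have "r < D * c"
    using c D by (simp add: r_def)
  have "r \<le> c * m"
  proof (cases "t < k - 1")
    case True
    then have "D * c \<le> c * m"
      using m by (simp add: m0_def mult.commute)
    then show ?thesis
      using \<open>r < D * c\<close> by linarith
  next
    case False
    \<comment> \<open>Here c = 1, so r \<le> D - 1 \<le> m; this is why the case t = k - 1 gets by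
      with D - 1.\<close>
    then show ?thesis
      using m c1 \<open>r < D * c\<close> by (auto simp: m0_def)
  qed
  moreover have "geometric_configuration_exists m t"
    using m conf by (auto simp: m0_def split: if_splits)
  ultimately have "geometric_configuration_exists (D * (c * m) + r) k"
    using t(1) unfolding c_def D_def by (intro geometric_configuration_exists_replication_switch)
  moreover have "n = D * (c * m) + r"
    by (simp add: m_def r_def flip: mult.assoc)
  ultimately show ?thesis by simp
qed

text \<open>\<open>config_threshold\<close> is a least positive number, so comparing it with
  \<open>N_hat\<close> requires positivity; k \<ge> 4 keeps the truncated subtractions
  positive.\<close>

lemma N_bound_pos:
  assumes "3 \<le> t" "t < k"
  shows "0 < N_bound k t a 1"
proof -
  have "4 * 4 \<le> k * k"
    using assms by (intro mult_mono) auto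
  moreover have "0 < fact k div (fact (t + 1) :: nat)"
    using assms by (simp add: div_greater_zero_iff fact_mono del: fact_Suc)
  ultimately show ?thesis
    by (auto simp: N_bound_def power2_eq_square less_max_iff_disj)
qed

section \<open>The recursive bound\<close>

lemma N_hat_eq_N_bound:
  assumes "5 \<le> k"
  obtains t where "3 \<le> t" "t < k" "N_hat k = N_bound k t (N_hat t) 1"
proof -
  have "N_hat k = Min ((\<lambda>t. N_bound k t (N_hat t) 1) ` {3..<k})"
    using assms by (subst N_hat.simps) auto
  moreover have "Min ((\<lambda>t. N_bound k t (N_hat t) 1) ` {3..<k}) \<in> (\<lambda>t. N_bound k t (N_hat t) 1) ` {3..<k}"
    using assms by (intro Min_in) auto
  ultimately show ?thesis
    using that by auto
qed

theorem theorem13: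
  fixes k :: nat
  assumes known_3: "\<forall>n\<ge>9. geometric_configuration_exists n 3"
    and known_4: "\<forall>n\<ge>24. geometric_configuration_exists n 4"
    and k: "k \<ge> 3"
  shows "config_threshold k \<le> N_hat k \<and>
         (\<forall>n\<ge>N_hat k. geometric_configuration_exists n k)"
proof -
  have hat34: "N_hat 3 = 9" "N_hat 4 = 24"
    by (subst N_hat.simps, simp)+
  have small: "k = 3 \<or> k = 4 \<or> 5 \<le> k" if "3 \<le> k" for k :: nat
    using that by linarith
  have ex: "\<forall>n\<ge>N_hat k. geometric_configuration_exists n k"
    using k
  \<comment> \<open>Strong induction, since the minimum may be attained at any t with 3 \<le> t <
    k.\<close>
  proof (induction k rule: less_induct)
    case (less k)
    show ?case
    proof (cases "5 \<le> k")
      case True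
      then obtain t where "3 \<le> t" "t < k" "N_hat k = N_bound k t (N_hat t) 1"
        by (rule N_hat_eq_N_bound)
      then show ?thesis
        using less.IH[of t] geometric_configuration_exists_N_bound[of "N_hat t" t k] by auto
    next
      case False
      then show ?thesis
        using small[OF less.prems] known_3 known_4 hat34 by auto
    qed
  qed
  have "0 < N_hat k"
    using small[OF k] hat34 by (metis N_bound_pos N_hat_eq_N_bound zero_less_numeral)
  then have "config_threshold k \<le> N_hat k"
    unfolding config_threshold_def using ex by (intro Least_le) simp
  with ex show ?thesis by simp
qed

end
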